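(* Let $m,n,d$ be positive integers and let $x\in(0,1]$ with $xn$ an integer. After all $m$ balls have been placed by $\mathrm{GREEDY}(m,n,d)$, the expected total number of balls in the $xn$ least-loaded bins is at most $x^d m$. Moreover, for every integer $k\ge 1$, the probability that the $xn$ least-loaded bins together contain at least $k$ balls is at most $$1-\sum_{i=0}^{k-1}\binom{m}{i}(1-x)^{m-i}x^{i}.$$
   Context: $\mathrm{GREEDY}(m,n,d)$ places $m$ balls into $n$ bins $B_1,\dots,B_n$ over time steps $t=1,\dots,m$. At each time step, $d$ indices are selected from $[n]=\{1,\dots,n\}$ independently and uniformly at random with replacement, forming a multiset $S_t$; the $t$-th ball is placed into a bin $B_M$ with $M\in S_t$ whose current load is maximal among the bins indexed by $S_t$; ties among maximal bins are broken uniformly at random. The load of a bin is the number of balls in it. "The number of balls in the $xn$ least-loaded bins" means the sum of the $xn$ smallest loads. *)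

theory Defs
  imports "HOL-Probability.Probability"
begin

text \<open>A configuration \<open>L :: nat \<Rightarrow> nat\<close> gives the load \<open>L b\<close> of each bin \<open>b \<in> {1..n}\<close>.\<close>

definition maximal_bins :: "(nat \<Rightarrow> nat) \<Rightarrow> nat set \<Rightarrow> nat set" where
  "maximal_bins L S = {b \<in> S. \<forall>c \<in> S. L c \<le> L b}"

text \<open>The \<open>d\<close> draws with replacement form a list \<open>bs\<close>.  Ties are broken uniformly among the
  distinct bins of maximal load in \<open>set bs\<close>; how often a bin was drawn does not matter.\<close>

definition greedy_step :: "nat \<Rightarrow> nat \<Rightarrow> (nat \<Rightarrow> nat) \<Rightarrow> (nat \<Rightarrow> nat) pmf" where
  "greedy_step n d L =
     do {
       bs \<leftarrow> replicate_pmf d (pmf_of_set {1..n});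
       b \<leftarrow> pmf_of_set (maximal_bins L (set bs));
       return_pmf (L(b := L b + 1))
     }"

primrec greedy :: "nat \<Rightarrow> nat \<Rightarrow> nat \<Rightarrow> (nat \<Rightarrow> nat) pmf" where
  "greedy 0 n d = return_pmf (\<lambda>_. 0)"
| "greedy (Suc m) n d = do { L \<leftarrow> greedy m n d; greedy_step n d L }"

definition least_loaded_balls :: "nat \<Rightarrow> nat \<Rightarrow> (nat \<Rightarrow> nat) \<Rightarrow> nat" where
  "least_loaded_balls n j L = sum_list (take j (sort (map L [1..<Suc n])))"

text \<open>Finite support: every expectation over \<open>greedy\<close> is a genuine finite sum, so the
  Bochner integral never takes its default value.\<close>

lemma finite_set_pmf_greedy:
  assumes "n > 0" "d > 0"
  shows "finite (set_pmf (greedy m n d))"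
proof (induction m)
  case 0
  then show ?case by simp
next
  case (Suc m)
  have "finite (set_pmf (greedy_step n d L))" for L
  proof -
    have S: "set_pmf (replicate_pmf d (pmf_of_set {1..n})) = {bs \<in> lists {1..n}. length bs = d}"
      using assms by (simp add: set_replicate_pmf)
    have fin: "finite {bs \<in> lists {1..n}. length bs = d}"
      using finite_lists_length_eq[of "{1..n}" d]
      by (rule rev_finite_subset) (auto simp: lists_eq_set)
    have "finite (set_pmf (pmf_of_set (maximal_bins L (set bs))))"
      if "bs \<in> {bs \<in> lists {1..n}. length bs = d}" for bs
    proof -
      have ne: "set bs \<noteq> {}" using that assms by auto
      have "Max (L ` set bs) \<in> L ` set bs" using ne by (intro Max_in) auto
      then obtain b where "b \<in> set bs" "L b = Max (L ` set bs)" by auto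
      then have "b \<in> maximal_bins L (set bs)"
        by (auto simp: maximal_bins_def)
      moreover have "finite (maximal_bins L (set bs))"
        by (auto simp: maximal_bins_def)
      ultimately show ?thesis by (metis empty_iff set_pmf_of_set)
    qed
    then show ?thesis
      unfolding greedy_step_def set_bind_pmf S using fin by (intro finite_UN_I) auto
  qed
  with Suc show ?case by simp
qed

end

theory Submission
  imports Defs
begin

text \<open>Let \<open>F L\<close> be the sum of the \<open>j\<close> smallest loads, i.e. the least total load of a \<open>j\<close>-element set
  of bins. Adding a ball to bin \<open>b\<close> raises \<open>F\<close> by at most one, and only if at most \<open>j\<close> bins have
  load \<open>\<le> L b\<close>: otherwise \<open>b\<close> can be exchanged for an equally good bin outside an optimal set.
  The bins with this property form a set of at most \<open>j\<close> bins that is downward closed with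
  respect to the load. As the chosen bin has maximal load among the draws, it lies in this set only
  if all \<open>d\<close> draws do, which has probability at most \<open>x ^ d\<close>. Hence every step can be coupled with a
  Bernoulli trial that succeeds whenever \<open>F\<close> grows, and the whole process with a binomial variable
  that is always at least \<open>F\<close>. Success probability \<open>x ^ d\<close> gives the expectation, and the
  larger success probability \<open>x\<close> gives the tails.\<close>

section \<open>Least sums over subsets of fixed size\<close>

definition min_subset_sum :: "('a \<Rightarrow> 'b :: {linorder, comm_monoid_add}) \<Rightarrow> 'a set \<Rightarrow> nat \<Rightarrow> 'b" where
  "min_subset_sum f A j = (MIN S \<in> {S. S \<subseteq> A \<and> card S = j}. sum f S)"

lemma min_subset_sum_attained:
  assumes "finite A" "j \<le> card A"
  obtains S where "S \<subseteq> A" "card S = j" "sum f S = min_subset_sum f A j"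
proof -
  have "{S. S \<subseteq> A \<and> card S = j} \<noteq> {}"
    using obtain_subset_with_card_n[OF assms(2)] by blast
  moreover have "finite {S. S \<subseteq> A \<and> card S = j}"
    using assms(1) by simp
  ultimately have "min_subset_sum f A j \<in> sum f ` {S. S \<subseteq> A \<and> card S = j}"
    unfolding min_subset_sum_def by (intro Min_in) auto
  then show thesis using that by force
qed

lemma min_subset_sum_le:
  assumes "finite A" "S \<subseteq> A"
  shows "min_subset_sum f A (card S) \<le> sum f S"
  unfolding min_subset_sum_def using assms by (intro Min_le) auto

lemma sum_le_sum_exchange:
  fixes f :: "'a \<Rightarrow> 'b :: ordered_comm_monoid_add"
  assumes "finite S" "finite T" "card S = card T"
    and f_le: "\<And>s t. s \<in> S - T \<Longrightarrow> t \<in> T - S \<Longrightarrow> f s \<le> f t"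
  shows "sum f S \<le> sum f T"
proof -
  have "card (S - T) = card (T - S)"
    using assms(1-3) by (metis Int_commute card_Diff_subset_Int finite_Int)
  then obtain h where h: "bij_betw h (S - T) (T - S)"
    using finite_same_card_bij assms(1,2) by (metis finite_Diff)
  have "sum f S = sum f (S \<inter> T) + sum f (S - T)"
    by (rule sum.Int_Diff[OF assms(1)])
  also have "sum f (S - T) \<le> (\<Sum>s\<in>S - T. f (h s))"
    using f_le bij_betwE[OF h] by (intro sum_mono) blast
  also have "\<dots> = sum f (T - S)"
    by (rule sum.reindex_bij_betw[OF h])
  also have "sum f (S \<inter> T) + sum f (T - S) = sum f T"
    using sum.Int_Diff[OF assms(2), of f S] by (simp add: Int_commute)
  finally show ?thesis by (simp add: add_left_mono)
qed

lemma min_subset_sum_eq_sum_smallest: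
  fixes f :: "'a \<Rightarrow> 'b :: {linorder, ordered_comm_monoid_add}"
  assumes "finite A" "S \<subseteq> A" and "\<And>s t. s \<in> S \<Longrightarrow> t \<in> A - S \<Longrightarrow> f s \<le> f t"
  shows "min_subset_sum f A (card S) = sum f S"
proof (rule antisym)
  show "min_subset_sum f A (card S) \<le> sum f S"
    by (rule min_subset_sum_le[OF assms(1,2)])
  obtain T where T: "T \<subseteq> A" "card T = card S" "sum f T = min_subset_sum f A (card S)"
    using min_subset_sum_attained[OF assms(1) card_mono[OF assms(1,2)]] .
  then have "sum f S \<le> sum f T"
    using assms by (intro sum_le_sum_exchange) (auto intro: finite_subset)
  then show "sum f S \<le> min_subset_sum f A (card S)"
    by (simp only: T(3))
qed

lemma sum_list_take_sort_map:
  fixes f :: "'a \<Rightarrow> 'b :: {linorder, ordered_comm_monoid_add}"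
  assumes "distinct xs" "j \<le> length xs"
  shows "sum_list (take j (sort (map f xs))) = min_subset_sum f (set xs) j"
proof -
  define ys where "ys = sort_key f xs"
  have ys: "distinct ys" "set ys = set xs" "length ys = length xs" "sorted (map f ys)"
    using assms(1) by (simp_all add: ys_def)
  define S where "S = set (take j ys)"
  have S: "S \<subseteq> set xs" "card S = j"
    using ys assms(2) set_take_subset[of j ys] by (auto simp: S_def distinct_card)
  have smallest: "f s \<le> f t" if "s \<in> S" "t \<in> set xs - S" for s t
  proof -
    have "t \<in> set (drop j ys)"
      using that(2) ys(2) by (metis DiffE S_def Un_iff append_take_drop_id set_append)
    moreover have "sorted (map f (take j ys) @ map f (drop j ys))"
      using ys(4) by (metis append_take_drop_id map_append)
    ultimately show ?thesis
      using that(1) by (auto simp: S_def sorted_append)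
  qed
  have "sort (map f xs) = map f ys"
    by (rule properties_for_sort) (simp_all add: ys_def)
  then have "sum_list (take j (sort (map f xs))) = sum f S"
    using ys(1) by (simp add: take_map sum_list_distinct_conv_sum_set S_def)
  also have "\<dots> = min_subset_sum f (set xs) j"
    using min_subset_sum_eq_sum_smallest[OF _ S(1) smallest] S(2) by simp
  finally show ?thesis .
qed

definition rank_in :: "'a set \<Rightarrow> ('a \<Rightarrow> 'b :: linorder) \<Rightarrow> 'a \<Rightarrow> nat" where
  "rank_in A f b = card {c \<in> A. f c \<le> f b}"

lemma rank_in_mono:
  assumes "finite A" "f c \<le> f b"
  shows "rank_in A f c \<le> rank_in A f b"
  unfolding rank_in_def using assms by (intro card_mono) auto

lemma card_rank_in_le:
  assumes "finite A"
  shows "card {b \<in> A. rank_in A f b \<le> j} \<le> j"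
proof (cases "{b \<in> A. rank_in A f b \<le> j} = {}")
  case True
  then show ?thesis by (simp only: card.empty le0)
next
  case False
  let ?B = "{b \<in> A. rank_in A f b \<le> j}"
  obtain b where b: "b \<in> ?B" "Max (f ` ?B) = f b"
    using obtains_MAX[of ?B f] assms False by auto
  have "f c \<le> f b" if "c \<in> ?B" for c
    using that assms by (simp flip: b(2))
  then have "card ?B \<le> rank_in A f b"
    unfolding rank_in_def using assms by (intro card_mono) auto
  then show ?thesis using b(1) by simp
qed

lemma min_subset_sum_attained_avoiding:
  fixes f :: "'a \<Rightarrow> 'b :: {linorder, ordered_comm_monoid_add}"
  assumes "finite A" "j < rank_in A f b"
  obtains S where "S \<subseteq> A" "card S = j" "sum f S = min_subset_sum f A j" "b \<notin> S"
proof -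
  have "rank_in A f b \<le> card A"
    unfolding rank_in_def using assms(1) by (intro card_mono) auto
  then obtain S where S: "S \<subseteq> A" "card S = j" "sum f S = min_subset_sum f A j"
    using min_subset_sum_attained[of A j f] assms by auto
  have fin: "finite S" using S(1) assms(1) finite_subset by blast
  show thesis
  proof (cases "b \<in> S")
    case False
    with S that show thesis by blast
  next
    case True
    have "\<not> {c \<in> A. f c \<le> f b} \<subseteq> S"
      using assms(2) S(2) card_mono[OF fin, of "{c \<in> A. f c \<le> f b}"] by (auto simp: rank_in_def)
    then obtain c where c: "c \<in> A" "f c \<le> f b" "c \<notin> S" by auto
    define T where "T = insert c (S - {b})"
    have T: "T \<subseteq> A" "card T = j" "b \<notin> T"
      using S c True fin card_Suc_Diff1[OF fin True] by (auto simp: T_def)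
    have "sum f T \<le> sum f S"
      using fin c True by (simp add: T_def sum.remove[of S b] add_right_mono)
    moreover have "min_subset_sum f A j \<le> sum f T"
      using min_subset_sum_le[OF assms(1) T(1), of f] T(2) by simp
    ultimately show thesis
      using that T S(3) by simp
  qed
qed

lemma min_subset_sum_increase_le:
  fixes f :: "'a \<Rightarrow> 'b :: {linorder, ordered_comm_monoid_add}"
  assumes "finite A" "j \<le> card A" "0 \<le> v"
  shows "min_subset_sum (f(b := f b + v)) A j
    \<le> min_subset_sum f A j + (if rank_in A f b \<le> j then v else 0)"
proof -
  obtain S where S: "S \<subseteq> A" "card S = j" "sum f S = min_subset_sum f A j"
    and avoid: "j < rank_in A f b \<Longrightarrow> b \<notin> S"
  proof (cases "j < rank_in A f b")
    case True
    with that show thesis using min_subset_sum_attained_avoiding[OF assms(1) True] by metis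
  next
    case False
    with that show thesis using min_subset_sum_attained[OF assms(1,2)] by metis
  qed
  have fin: "finite S" using S(1) assms(1) finite_subset by blast
  have "min_subset_sum (f(b := f b + v)) A j \<le> sum (f(b := f b + v)) S"
    using min_subset_sum_le[OF assms(1) S(1)] S(2) by metis
  also have "\<dots> = (\<Sum>c\<in>S. f c + (if c = b then v else 0))"
    by (intro sum.cong) auto
  also have "\<dots> = sum f S + (if b \<in> S then v else 0)"
    using fin by (simp add: sum.distrib)
  also have "\<dots> \<le> min_subset_sum f A j + (if rank_in A f b \<le> j then v else 0)"
    using S(3) avoid assms(3) by (auto simp: not_le intro: add_increasing2)
  finally show ?thesis .
qed

section \<open>Coupling with Bernoulli trials\<close>

lemma rel_pmf_bernoulli_pmf_mono:
  assumes "0 \<le> p" "p \<le> q" "q \<le> 1"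
  shows "rel_pmf (\<longrightarrow>) (bernoulli_pmf p) (bernoulli_pmf q)"
proof -
  define r where "r = p / q"  \<comment> \<open>for \<open>q = 0\<close> also \<open>p = 0\<close>, and division by zero gives \<open>r = 0\<close>\<close>
  have r: "0 \<le> r" "r \<le> 1" "r * q = p"
    using assms by (auto simp: r_def divide_simps)
  have thinning: "bernoulli_pmf p
      = bind_pmf (bernoulli_pmf q) (\<lambda>b. map_pmf (\<lambda>c. b \<and> c) (bernoulli_pmf r))"
  proof (rule pmf_eqI)
    fix c
    have "pmf (map_pmf (\<lambda>c. b \<and> c) (bernoulli_pmf r)) c
        = (if b then pmf (bernoulli_pmf r) c else of_bool (\<not> c))" for b
      by (cases b) (auto simp: map_pmf_const)
    then show "pmf (bernoulli_pmf p) c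
        = pmf (bind_pmf (bernoulli_pmf q) (\<lambda>b. map_pmf (\<lambda>c. b \<and> c) (bernoulli_pmf r))) c"
      using assms r by (cases c) (simp_all add: pmf_bind algebra_simps)
  qed
  have "rel_pmf (\<longrightarrow>) (bind_pmf (bernoulli_pmf q) (\<lambda>b. map_pmf (\<lambda>c. b \<and> c) (bernoulli_pmf r)))
      (bind_pmf (bernoulli_pmf q) return_pmf)"
    by (rule rel_pmf_bindI[where R = "(=)"]) (auto simp: rel_pmf_return_pmf2 pmf.rel_eq)
  then show ?thesis by (simp add: thinning bind_return_pmf')
qed

lemma map_pmf_mem_eq_bernoulli_pmf:
  "map_pmf (\<lambda>x. x \<in> A) p = bernoulli_pmf (measure_pmf.prob p A)"
proof (rule pmf_eqI)
  fix b
  have "(\<lambda>x. x \<in> A) -` {b} = (if b then A else - A)" by auto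
  then show "pmf (map_pmf (\<lambda>x. x \<in> A) p) b = pmf (bernoulli_pmf (measure_pmf.prob p A)) b"
    using measure_pmf.prob_compl[of A p] by (cases b) (simp_all add: pmf_map Compl_eq_Diff_UNIV)
qed

lemma rel_pmf_bernoulli_pmfI:
  assumes "measure_pmf.prob p A \<le> q" "q \<le> 1"
  shows "rel_pmf (\<lambda>x b. x \<in> A \<longrightarrow> b) p (bernoulli_pmf q)"
  using rel_pmf_bernoulli_pmf_mono[OF measure_nonneg assms]
  by (simp flip: map_pmf_mem_eq_bernoulli_pmf add: pmf.rel_map)

lemma rel_pmf_bind_binomial_pmf_Suc:
  fixes F :: "'a \<Rightarrow> nat"
  assumes "q \<in> {0..1}"
    and "rel_pmf (\<lambda>x k. F x \<le> k) p (binomial_pmf m q)"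
    and step: "\<And>x. rel_pmf (\<lambda>y b. F y \<le> F x + of_bool b) (K x) (bernoulli_pmf q)"
  shows "rel_pmf (\<lambda>x k. F x \<le> k) (bind_pmf p K) (binomial_pmf (Suc m) q)"
proof -
  have binomial_Suc: "binomial_pmf (Suc m) q
      = bind_pmf (binomial_pmf m q) (\<lambda>k. map_pmf (\<lambda>b. k + of_bool b) (bernoulli_pmf q))"
    unfolding binomial_pmf_Suc[OF assms(1)] map_pmf_def
    by (subst bind_commute_pmf) (simp add: of_bool_def add.commute)
  have "rel_pmf (\<lambda>y i. F y \<le> i) (K x) (map_pmf (\<lambda>b. k + of_bool b) (bernoulli_pmf q))"
    if "F x \<le> k" for x k
    using that unfolding pmf.rel_map by (intro pmf.rel_mono_strong[OF step[of x]]) simp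
  then show ?thesis
    unfolding binomial_Suc by (rule rel_pmf_bindI[OF assms(2)])
qed

lemma rel_pmf_binomial_pmf_imp_expectation_le:
  assumes "rel_pmf (\<lambda>x k. F x \<le> k) p (binomial_pmf m q)" "q \<in> {0..1}"
  shows "measure_pmf.expectation p (\<lambda>x. real (F x)) \<le> real m * q"
proof -
  obtain pq where coupled: "\<And>x k. (x, k) \<in> set_pmf pq \<Longrightarrow> F x \<le> k"
    and marginals: "map_pmf fst pq = p" "map_pmf snd pq = binomial_pmf m q"
    using assms(1) by (auto elim: rel_pmf.cases)
  have "integrable (map_pmf snd pq) real"
    unfolding marginals(2) by (rule integrable_binomial_pmf[OF assms(2)])
  then have "measure_pmf.expectation pq (\<lambda>z. real (F (fst z)))
      \<le> measure_pmf.expectation pq (\<lambda>z. real (snd z))"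
    by (intro integral_mono_AE') (auto simp: AE_measure_pmf_iff coupled)
  then have "measure_pmf.expectation p (\<lambda>x. real (F x))
      \<le> measure_pmf.expectation (binomial_pmf m q) real"
    by (simp flip: marginals)
  also have "\<dots> = (\<Sum>k\<le>m. real k * Bernstein m k q)"
    by (simp add: expectation_binomial_pmf'[OF assms(2)] Bernstein_def mult_ac)
  also have "\<dots> = real m * q"
    by (rule sum_k_Bernstein)
  finally show ?thesis .
qed

lemma rel_pmf_binomial_pmf_imp_prob_ge_le:
  assumes "rel_pmf (\<lambda>x k. F x \<le> k) p (binomial_pmf m q)" "q \<in> {0..1}"
  shows "measure_pmf.prob p {x. k \<le> F x}
    \<le> 1 - (\<Sum>i<k. real (m choose i) * (1 - q) ^ (m - i) * q ^ i)"
proof -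
  have "measure_pmf.prob p {x. k \<le> F x}
      \<le> measure_pmf.prob (binomial_pmf m q) {i. \<exists>x\<in>{x. k \<le> F x}. F x \<le> i}"
    by (rule rel_pmf_measureD[OF assms(1)])
  also have "\<dots> \<le> measure_pmf.prob (binomial_pmf m q) (UNIV - {..<k})"
    by (intro measure_pmf.finite_measure_mono) auto
  also have "\<dots> = 1 - measure_pmf.prob (binomial_pmf m q) {..<k}"
    using measure_pmf.prob_compl[of "{..<k}" "binomial_pmf m q"] by simp
  also have "measure_pmf.prob (binomial_pmf m q) {..<k} = (\<Sum>i<k. pmf (binomial_pmf m q) i)"
    by (simp add: measure_measure_pmf_finite)
  also have "\<dots> = (\<Sum>i<k. real (m choose i) * (1 - q) ^ (m - i) * q ^ i)"
    using assms(2) by (simp add: mult_ac)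
  finally show ?thesis .
qed

lemma prob_replicate_pmf_subset:
  "measure_pmf.prob (replicate_pmf d p) {xs. set xs \<subseteq> A} = measure_pmf.prob p A ^ d"
proof (induction d)
  case (Suc d)
  let ?B = "{xs. set xs \<subseteq> A}"
  have "replicate_pmf (Suc d) p = bind_pmf p (\<lambda>x. map_pmf ((#) x) (replicate_pmf d p))"
    by (simp add: map_pmf_def)
  moreover have "emeasure (map_pmf ((#) x) (replicate_pmf d p)) ?B
      = indicator A x * emeasure (replicate_pmf d p) ?B" for x
    by (auto simp: indicator_def vimage_def)
  ultimately have "emeasure (replicate_pmf (Suc d) p) ?B
      = emeasure p A * emeasure (replicate_pmf d p) ?B"
    by (simp add: nn_integral_multc del: replicate_pmf.simps)
  then show ?case
    by (simp add: measure_def enn2real_mult Suc[unfolded measure_def])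
qed simp

lemma prob_replicate_pmf_of_set_subset_le:
  assumes "finite B" "B \<noteq> {}" "A \<subseteq> B" "card A \<le> j"
  shows "measure_pmf.prob (replicate_pmf d (pmf_of_set B)) {xs. set xs \<subseteq> A}
    \<le> (real j / real (card B)) ^ d"
proof -
  have "B \<inter> A = A" using assms(3) by blast
  then have "measure_pmf.prob (replicate_pmf d (pmf_of_set B)) {xs. set xs \<subseteq> A}
      = (real (card A) / real (card B)) ^ d"
    using assms(1,2) by (simp add: prob_replicate_pmf_subset measure_pmf_of_set)
  also have "\<dots> \<le> (real j / real (card B)) ^ d"
    using assms(4) by (intro power_mono divide_right_mono) auto
  finally show ?thesis .
qed

section \<open>The greedy process\<close>

lemma least_loaded_balls_eq_min_subset_sum:
  assumes "j \<le> n"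
  shows "least_loaded_balls n j L = min_subset_sum L {1..n} j"
proof -
  have "set [1..<Suc n] = {1..n}" by auto
  then show ?thesis
    unfolding least_loaded_balls_def
    using sum_list_take_sort_map[of "[1..<Suc n]" j L] assms by (simp del: upt_Suc)
qed

lemma least_loaded_balls_add_ball_le:
  assumes "j \<le> n"
  shows "least_loaded_balls n j (L(b := L b + 1))
    \<le> least_loaded_balls n j L + of_bool (rank_in {1..n} L b \<le> j)"
  using min_subset_sum_increase_le[of "{1..n}" j 1 L b] assms
  by (simp add: least_loaded_balls_eq_min_subset_sum of_bool_def)

lemma least_loaded_balls_add_ball_maximal_bin_le:
  assumes "j \<le> n" "S \<subseteq> {1..n}" "c \<in> maximal_bins L S"
  shows "least_loaded_balls n j (L(c := L c + 1))
    \<le> least_loaded_balls n j L + of_bool (\<forall>b\<in>S. rank_in {1..n} L b \<le> j)"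
proof -
  have "rank_in {1..n} L b \<le> rank_in {1..n} L c" if "b \<in> S" for b
    using that assms(3) by (intro rank_in_mono) (auto simp: maximal_bins_def)
  then have "of_bool (rank_in {1..n} L c \<le> j) \<le> (of_bool (\<forall>b\<in>S. rank_in {1..n} L b \<le> j) :: nat)"
    by (auto simp: of_bool_def intro: order_trans)
  then show ?thesis
    using least_loaded_balls_add_ball_le[OF assms(1), of L c] by linarith
qed

lemma set_pmf_of_set_maximal_bins:
  assumes "finite S" "S \<noteq> {}"
  shows "set_pmf (pmf_of_set (maximal_bins L S)) = maximal_bins L S"
proof (rule set_pmf_of_set)
  obtain b where "b \<in> S" "Max (L ` S) = L b" using obtains_MAX[OF assms] .
  then have "b \<in> maximal_bins L S"
    using assms by (auto simp: maximal_bins_def simp flip: \<open>Max (L ` S) = L b\<close>)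
  then show "maximal_bins L S \<noteq> {}" by blast
  show "finite (maximal_bins L S)" using assms(1) by (simp add: maximal_bins_def)
qed

lemma rel_pmf_greedy_step_bernoulli_pmf:
  assumes "n > 0" "d > 0" "j \<le> n" "(real j / real n) ^ d \<le> q" "q \<le> 1"
  shows "rel_pmf (\<lambda>L' b. least_loaded_balls n j L' \<le> least_loaded_balls n j L + of_bool b)
    (greedy_step n d L) (bernoulli_pmf q)" (is "rel_pmf ?grows_only_if _ _")
proof -
  define A where "A = {b \<in> {1..n}. rank_in {1..n} L b \<le> j}"
  let ?draws = "replicate_pmf d (pmf_of_set {1..n})"
  have "measure_pmf.prob ?draws {bs. set bs \<subseteq> A} \<le> (real j / real (card {1..n})) ^ d"
    using assms(1) unfolding A_def
    by (intro prob_replicate_pmf_of_set_subset_le card_rank_in_le) auto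
  then have "rel_pmf (\<lambda>bs b. bs \<in> {bs. set bs \<subseteq> A} \<longrightarrow> b) ?draws (bernoulli_pmf q)"
    using assms(4,5) by (intro rel_pmf_bernoulli_pmfI) auto
  then have "rel_pmf (\<lambda>bs b. bs \<in> set_pmf ?draws \<and> (set bs \<subseteq> A \<longrightarrow> b)) ?draws (bernoulli_pmf q)"
    by (rule pmf.rel_mono_strong) simp
  then have "rel_pmf ?grows_only_if (greedy_step n d L) (bind_pmf (bernoulli_pmf q) return_pmf)"
    unfolding greedy_step_def
  proof (rule rel_pmf_bindI)
    fix bs b
    assume "bs \<in> set_pmf ?draws \<and> (set bs \<subseteq> A \<longrightarrow> b)"
    then have bs: "set bs \<subseteq> {1..n}" "set bs \<noteq> {}"
      and low: "\<forall>c\<in>set bs. rank_in {1..n} L c \<le> j \<Longrightarrow> b"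
      using assms(1,2) by (auto simp: set_replicate_pmf A_def)
    have "?grows_only_if (L(c := L c + 1)) b" if "c \<in> maximal_bins L (set bs)" for c
      using least_loaded_balls_add_ball_maximal_bin_le[OF assms(3) bs(1) that] low
      by (cases b) (auto simp: of_bool_def split: if_splits)
    then show "rel_pmf ?grows_only_if
        (pmf_of_set (maximal_bins L (set bs)) \<bind> (\<lambda>c. return_pmf (L(c := L c + 1)))) (return_pmf b)"
      using bs(2) by (auto simp: rel_pmf_return_pmf2 set_pmf_of_set_maximal_bins)
  qed
  then show ?thesis by (simp add: bind_return_pmf')
qed

lemma rel_pmf_greedy_binomial_pmf:
  assumes "n > 0" "d > 0" "j \<le> n" "(real j / real n) ^ d \<le> q" "q \<le> 1"
  shows "rel_pmf (\<lambda>L k. least_loaded_balls n j L \<le> k) (greedy m n d) (binomial_pmf m q)"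
proof -
  have "0 \<le> (real j / real n) ^ d" by simp
  from order_trans[OF this assms(4)] have q: "q \<in> {0..1}" using assms(5) by simp
  show ?thesis
  proof (induction m)
    case 0
    have "least_loaded_balls n j (\<lambda>_. 0) = 0"
      using min_subset_sum_attained[of "{1..n}" j "\<lambda>_. 0 :: nat"] assms(3)
      by (auto simp: least_loaded_balls_eq_min_subset_sum)
    then show ?case by (simp add: binomial_pmf_0[OF q])
  next
    case (Suc m)
    show ?case
      using rel_pmf_bind_binomial_pmf_Suc[OF q Suc rel_pmf_greedy_step_bernoulli_pmf[OF assms]]
      by simp
  qed
qed

theorem theorem4p1:
  fixes m n d j :: nat and x :: real
  assumes "m > 0" and "n > 0" and "d > 0"
    and "0 < x" and "x \<le> 1"
    and "x * real n = real j"
  shows "measure_pmf.expectation (greedy m n d) (\<lambda>L. real (least_loaded_balls n j L))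
           \<le> x ^ d * real m
       \<and> (\<forall>k\<ge>1. measure_pmf.prob (greedy m n d) {L. k \<le> least_loaded_balls n j L}
           \<le> 1 - (\<Sum>i = 0..k - 1. real (m choose i) * (1 - x) ^ (m - i) * x ^ i))"
proof (intro conjI allI impI)
  have x: "real j / real n = x"
    using assms(2,6) by (simp add: field_simps)
  have "real j \<le> real n"
    using assms(5,6) mult_right_mono[of x 1 "real n"] by simp
  then have "j \<le> n" by simp
  note coupling = rel_pmf_greedy_binomial_pmf[OF assms(2,3) this, unfolded x]
  have "x ^ d \<le> 1" using assms(4,5) by (simp add: power_le_one)
  then show "measure_pmf.expectation (greedy m n d) (\<lambda>L. real (least_loaded_balls n j L))
      \<le> x ^ d * real m"
    using rel_pmf_binomial_pmf_imp_expectation_le[OF coupling[of "x ^ d" m]] assms(4)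
    by (simp add: mult.commute)
  fix k :: nat
  assume "k \<ge> 1"
  then have "{0..k - 1} = {..<k}" by auto
  moreover have "x ^ d \<le> x"
    using assms(3,4,5) power_decreasing[of 1 d x] by simp
  ultimately show "measure_pmf.prob (greedy m n d) {L. k \<le> least_loaded_balls n j L}
      \<le> 1 - (\<Sum>i = 0..k - 1. real (m choose i) * (1 - x) ^ (m - i) * x ^ i)"
    using rel_pmf_binomial_pmf_imp_prob_ge_le[OF coupling[of x m], of k] assms(4,5) by simp
qed

end
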